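(* Let $m\ge 3$ and let $C_1,\ldots,C_m,\mathcal S\subset\mathbb R^n$ be nonempty, closed and convex sets that are pairwise disjoint, that is, $C_i\cap C_j=\emptyset$ for all $i\ne j$ and $C_i\cap\mathcal S=\emptyset$ for all $i$. Let $\rho_1,\ldots,\rho_m\ge 0$ and $\omega_1,\ldots,\omega_m\ge 0$. Then a point $\mathbf u^*=(a_1^*,\ldots,a_m^*,x^* )\in\Omega$ is a global optimal solution of the Generalized Heron--Waist Problem $\min_{\mathbf u\in\Omega}J(\mathbf u)$ if and only if there exist normal vectors $n_{C_i}\in N_{C_i}(a_i^* )$ for $i=1,\ldots,m$ and $n_{\mathcal S}\in N_{\mathcal S}(x^* )$ satisfying all of the following: (O1) for each $i=1,\ldots,m$, $$\rho_{i-1}\frac{a_i^*-a_{i-1}^*}{\|a_i^*-a_{i-1}^*\|}+\rho_i\frac{a_i^*-a_{i+1}^*}{\|a_i^*-a_{i+1}^*\|}+\omega_i\frac{a_i^*-x^*}{\|a_i^*-x^*\|}+n_{C_i}=\mathbf 0,$$ where indices are cyclic: $a_0^*:=a_m^*$, $a_{m+1}^*:=a_1^*$, $\rho_0:=\rho_m$; (O2) $$\sum_{i=1}^m\omega_i\frac{x^*-a_i^*}{\|x^*-a_i^*\|}+n_{\mathcal S}=\mathbf 0;$$ (O3) $$\sum_{i=1}^m n_{C_i}+n_{\mathcal S}=\mathbf 0.$$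
   Context: The space $\mathbb R^n$ carries the standard inner product $\langle\cdot,\cdot\rangle$ and Euclidean norm $\|\cdot\|$. The feasible set is $\Omega:=C_1\times\cdots\times C_m\times\mathcal S\subset\mathbb R^{n(m+1)}$, and for $\mathbf u=(a_1,\ldots,a_m,x)$ the objective is $$J(\mathbf u):=\sum_{i=1}^m\rho_i\|a_i-a_{i+1}\|+\sum_{i=1}^m\omega_i\|a_i-x\|,\qquad a_{m+1}:=a_1.$$ For a closed convex set $C\subset\mathbb R^n$ and $y\in C$, the normal cone is $N_C(y):=\{v\in\mathbb R^n\mid\langle v,z-y\rangle\le 0\ \ \forall z\in C\}$. *)

theory Defs
  imports "HOL-Analysis.Analysis"
begin

(* Only meaningful for y in C. *)
definition normal_cone :: "('a::real_inner) set \<Rightarrow> 'a \<Rightarrow> 'a set" where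
  "normal_cone C y = {v. \<forall>z\<in>C. v \<bullet> (z - y) \<le> 0}"

(* Indices run through {1..m}, cyclically: the successor of m is 1, the predecessor of 1 is m. *)
definition cnext :: "nat \<Rightarrow> nat \<Rightarrow> nat" where
  "cnext m i = (if i = m then 1 else i + 1)"

definition cprev :: "nat \<Rightarrow> nat \<Rightarrow> nat" where
  "cprev m i = (if i = 1 then m else i - 1)"

(* A point u = (a_1, ..., a_m, x) is a pair (a, x), where a is extensional on {1..m},
   i.e. takes a fixed dummy value elsewhere. *)
definition hw_feasible ::
    "nat \<Rightarrow> (nat \<Rightarrow> (real^'n) set) \<Rightarrow> (real^'n) set \<Rightarrow> ((nat \<Rightarrow> real^'n) \<times> (real^'n)) set" where
  "hw_feasible m C S = (\<Pi>\<^sub>E i\<in>{1..m}. C i) \<times> S"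

definition hw_objective ::
    "nat \<Rightarrow> (nat \<Rightarrow> real) \<Rightarrow> (nat \<Rightarrow> real) \<Rightarrow> (nat \<Rightarrow> real^'n) \<times> (real^'n) \<Rightarrow> real" where
  "hw_objective m \<rho> \<omega> = (\<lambda>(a, x).
     (\<Sum>i=1..m. \<rho> i * norm (a i - a (cnext m i))) + (\<Sum>i=1..m. \<omega> i * norm (a i - x)))"

definition hw_optimal ::
    "nat \<Rightarrow> (nat \<Rightarrow> (real^'n) set) \<Rightarrow> (real^'n) set \<Rightarrow> (nat \<Rightarrow> real) \<Rightarrow> (nat \<Rightarrow> real)
      \<Rightarrow> (nat \<Rightarrow> real^'n) \<times> (real^'n) \<Rightarrow> bool" where
  "hw_optimal m C S \<rho> \<omega> u \<longleftrightarrow>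
     is_arg_min (hw_objective m \<rho> \<omega>) (\<lambda>v. v \<in> hw_feasible m C S) u"

end

theory Submission
  imports Defs
begin

text \<open>
  The objective \<open>J\<close> is a nonnegative combination of norms of linear images of \<open>(a, x)\<close>. At a
  feasible point the disjointness of the sets keeps all these images away from \<open>0\<close>, so every norm
  is differentiable there, with gradient the unit vector \<open>sgn p = p / \<parallel>p\<parallel>\<close>. Being convex and
  differentiable, \<open>J\<close> is minimal at \<open>(a, x)\<close> over the convex set \<open>\<Omega>\<close> iff its directional
  derivative \<open>hw_slope\<close> is nonnegative towards each feasible point (\<open>hw_optimal_iff_slope_nonneg\<close>).

  Shifting the cyclic index in the sum over the edges of the polygon writes this derivative as
  \<open>\<Sum>i. G\<^sub>i \<bullet> v\<^sub>i + G\<^sub>x \<bullet> w\<close> with the partial gradients \<open>G\<^sub>i\<close> and \<open>G\<^sub>x\<close>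
  (\<open>hw_slope_eq_gradients\<close>). As \<open>\<Omega>\<close> is a product, nonnegativity decouples into the conditions that
  \<open>- G\<^sub>i\<close> is normal to \<open>C\<^sub>i\<close> at \<open>a\<^sub>i\<close> and \<open>- G\<^sub>x\<close> is normal to \<open>S\<close> at \<open>x\<close>. The vertex
  and centre equations just say that the normal vectors are these negative gradients. The
  condition that the normal vectors sum to \<open>0\<close> is then automatic, since \<open>J\<close> does not change when
  all points are translated by the same vector and hence the partial gradients sum to \<open>0\<close>.
\<close>

definition hw_slope ::
    "nat \<Rightarrow> (nat \<Rightarrow> real) \<Rightarrow> (nat \<Rightarrow> real) \<Rightarrow> (nat \<Rightarrow> real^'n) \<Rightarrow> real^'n
      \<Rightarrow> (nat \<Rightarrow> real^'n) \<Rightarrow> real^'n \<Rightarrow> real" where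
  "hw_slope m \<rho> \<omega> a x v w =
     (\<Sum>i=1..m. \<rho> i * (sgn (a i - a (cnext m i)) \<bullet> (v i - v (cnext m i))))
     + (\<Sum>i=1..m. \<omega> i * (sgn (a i - x) \<bullet> (v i - w)))"

definition hw_gradient_vertex ::
    "nat \<Rightarrow> (nat \<Rightarrow> real) \<Rightarrow> (nat \<Rightarrow> real) \<Rightarrow> (nat \<Rightarrow> real^'n) \<Rightarrow> real^'n \<Rightarrow> nat \<Rightarrow> real^'n" where
  "hw_gradient_vertex m \<rho> \<omega> a x i =
     \<rho> (cprev m i) *\<^sub>R sgn (a i - a (cprev m i))
     + \<rho> i *\<^sub>R sgn (a i - a (cnext m i)) + \<omega> i *\<^sub>R sgn (a i - x)"

definition hw_gradient_centre ::
    "nat \<Rightarrow> (nat \<Rightarrow> real) \<Rightarrow> (nat \<Rightarrow> real^'n) \<Rightarrow> real^'n \<Rightarrow> real^'n" where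
  "hw_gradient_centre m \<omega> a x = (\<Sum>i=1..m. \<omega> i *\<^sub>R sgn (x - a i))"

lemma sum_cnext_eq_sum_cprev:
  fixes f :: "nat \<Rightarrow> nat \<Rightarrow> 'b::comm_monoid_add"
  shows "(\<Sum>i=1..m. f i (cnext m i)) = (\<Sum>i=1..m. f (cprev m i) i)"
  by (rule sum.reindex_bij_witness[where i = "cprev m" and j = "cnext m"])
     (auto simp: cnext_def cprev_def split: if_splits)

lemma hw_slope_eq_gradients:
  "hw_slope m \<rho> \<omega> a x v w =
     (\<Sum>i=1..m. hw_gradient_vertex m \<rho> \<omega> a x i \<bullet> v i) + hw_gradient_centre m \<omega> a x \<bullet> w"
proof -
  let ?e = "\<lambda>i j. sgn (a i - a j)"
  have neg: "sgn (p - q) = - sgn (q - p)" for p q :: "real^'a"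
    by (metis minus_diff_eq sgn_minus)
  have edges: "(\<Sum>i=1..m. \<rho> i * (?e i (cnext m i) \<bullet> (v i - v (cnext m i))))
      = (\<Sum>i=1..m. \<rho> i * (?e i (cnext m i) \<bullet> v i))
        + (\<Sum>i=1..m. \<rho> (cprev m i) * (?e i (cprev m i) \<bullet> v i))"
  proof -
    have "(\<Sum>i=1..m. \<rho> i * (?e i (cnext m i) \<bullet> (v i - v (cnext m i))))
        = (\<Sum>i=1..m. \<rho> i * (?e i (cnext m i) \<bullet> v i))
          + (\<Sum>i=1..m. \<rho> i * (?e (cnext m i) i \<bullet> v (cnext m i)))"
      unfolding sum.distrib[symmetric]
      by (rule sum.cong[OF refl], subst (3) neg) (simp add: inner_diff_right algebra_simps)
    then show ?thesis
      using sum_cnext_eq_sum_cprev[of "\<lambda>i j. \<rho> i * (?e j i \<bullet> v j)" m] by simp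
  qed
  have spokes: "(\<Sum>i=1..m. \<omega> i * (sgn (a i - x) \<bullet> (v i - w)))
      = (\<Sum>i=1..m. \<omega> i * (sgn (a i - x) \<bullet> v i)) + hw_gradient_centre m \<omega> a x \<bullet> w"
    unfolding hw_gradient_centre_def inner_sum_left sum.distrib[symmetric]
    by (rule sum.cong[OF refl], subst (3) neg) (simp add: inner_diff_right algebra_simps)
  show ?thesis
    unfolding hw_slope_def edges spokes hw_gradient_vertex_def
    by (simp add: inner_add_left sum.distrib)
qed

text \<open>
  Moving all points by one vector \<open>c\<close> leaves every difference unchanged, so the slope in this
  direction is \<open>0\<close>; choosing \<open>c\<close> to be the sum of the gradients shows that this sum vanishes.
\<close>
lemma hw_gradients_sum_zero:
  "(\<Sum>i=1..m. hw_gradient_vertex m \<rho> \<omega> a x i) + hw_gradient_centre m \<omega> a x = 0" (is "?s = 0")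
proof -
  have "hw_slope m \<rho> \<omega> a x (\<lambda>_. ?s) ?s = 0"
    by (simp add: hw_slope_def)
  then have "?s \<bullet> ?s = 0"
    unfolding hw_slope_eq_gradients by (simp add: inner_add_left inner_sum_left)
  then show ?thesis
    by simp
qed

text \<open>
  The unit vector \<open>sgn p\<close> is a subgradient of the norm at \<open>p\<close>, by Cauchy--Schwarz; for \<open>p = 0\<close> it
  is \<open>0\<close>, which is a subgradient as well.
\<close>
lemma norm_subgradient:
  fixes p q :: "'a::real_inner"
  shows "norm p + sgn p \<bullet> (q - p) \<le> norm q"
proof (cases "p = 0")
  case False
  have "sgn p \<bullet> q \<le> norm q"
    using norm_cauchy_schwarz[of "sgn p" q] False by (simp add: norm_sgn)
  moreover have "sgn p \<bullet> p = norm p"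
    using False by (simp add: sgn_div_norm dot_square_norm power2_eq_square)
  ultimately show ?thesis
    by (simp add: inner_diff_right)
qed simp

text \<open>
  Sufficiency of the first-order condition comes from this bound: the linearization supports \<open>J\<close>
  from below because each norm lies above its own linearization and all weights are nonnegative.
\<close>
lemma hw_objective_ge_linearization:
  assumes "\<And>i. i \<in> {1..m} \<Longrightarrow> \<rho> i \<ge> 0" and "\<And>i. i \<in> {1..m} \<Longrightarrow> \<omega> i \<ge> 0"
  shows "hw_objective m \<rho> \<omega> (a, x) + hw_slope m \<rho> \<omega> a x (\<lambda>i. b i - a i) (y - x)
    \<le> hw_objective m \<rho> \<omega> (b, y)"
proof -
  have scaled: "r * norm p + r * (sgn p \<bullet> d) \<le> r * norm q"
    if "r \<ge> 0" and "d = q - p" for r and p q d :: "real^'a"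
    using mult_left_mono[OF norm_subgradient[of p q] that(1)] that(2)
    by (simp add: distrib_left)
  have "(\<Sum>i=1..m. \<rho> i * norm (a i - a (cnext m i)))
        + (\<Sum>i=1..m. \<rho> i * (sgn (a i - a (cnext m i)) \<bullet> (b i - a i - (b (cnext m i) - a (cnext m i)))))
      \<le> (\<Sum>i=1..m. \<rho> i * norm (b i - b (cnext m i)))"
    unfolding sum.distrib[symmetric]
    by (intro sum_mono scaled assms(1)) auto
  moreover have "(\<Sum>i=1..m. \<omega> i * norm (a i - x))
        + (\<Sum>i=1..m. \<omega> i * (sgn (a i - x) \<bullet> (b i - a i - (y - x))))
      \<le> (\<Sum>i=1..m. \<omega> i * norm (b i - y))"
    unfolding sum.distrib[symmetric]
    by (intro sum_mono scaled assms(2)) auto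
  ultimately show ?thesis
    by (simp add: hw_objective_def hw_slope_def)
qed

lemma norm_line_has_derivative:
  fixes p d :: "'a::real_inner"
  assumes "p \<noteq> 0"
  shows "((\<lambda>t. norm (p + t *\<^sub>R d)) has_real_derivative (sgn p \<bullet> d)) (at 0)"
proof -
  have line: "((\<lambda>t. p + t *\<^sub>R d) has_derivative (\<lambda>t. t *\<^sub>R d)) (at 0)"
    by (auto intro!: derivative_eq_intros)
  have "((\<lambda>t. norm (p + t *\<^sub>R d)) has_derivative (\<lambda>t. (t *\<^sub>R d) \<bullet> sgn p)) (at 0)"
    by (rule has_derivative_compose[OF line]) (simp add: has_derivative_norm assms)
  then show ?thesis
    by (simp add: has_field_derivative_def inner_commute mult_commute_abs)
qed

lemma hw_objective_has_slope:
  assumes "\<And>i. i \<in> {1..m} \<Longrightarrow> a i \<noteq> a (cnext m i)" and "\<And>i. i \<in> {1..m} \<Longrightarrow> a i \<noteq> x"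
  shows "((\<lambda>t. hw_objective m \<rho> \<omega> (\<lambda>i. a i + t *\<^sub>R v i, x + t *\<^sub>R w))
    has_real_derivative hw_slope m \<rho> \<omega> a x v w) (at 0)"
proof -
  have regroup: "(p + t *\<^sub>R d) - (q + t *\<^sub>R e) = (p - q) + t *\<^sub>R (d - e)"
    for t and p q d e :: "real^'a"
    by (simp add: algebra_simps)
  show ?thesis
    unfolding hw_objective_def hw_slope_def prod.case regroup
    by (intro DERIV_add DERIV_sum DERIV_cmult norm_line_has_derivative) (use assms in auto)
qed

text \<open>
  Outside \<open>{1..m}\<close> the maps \<open>a\<close> and \<open>b\<close> share the same dummy value, so the segment is constant
  there and its points remain extensional.
\<close>
lemma hw_feasible_segment:
  assumes "(a, x) \<in> hw_feasible m C S" and "(b, y) \<in> hw_feasible m C S"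
    and "\<And>i. i \<in> {1..m} \<Longrightarrow> convex (C i)" and "convex S" and "0 \<le> t" "t \<le> 1"
  shows "(\<lambda>i. a i + t *\<^sub>R (b i - a i), x + t *\<^sub>R (y - x)) \<in> hw_feasible m C S"
proof -
  have seg: "p + t *\<^sub>R (q - p) \<in> K" if "convex K" "p \<in> K" "q \<in> K" for p q and K :: "(real^'a) set"
  proof -
    have "p + t *\<^sub>R (q - p) = (1 - t) *\<^sub>R p + t *\<^sub>R q"
      by (simp add: algebra_simps)
    then show ?thesis
      using convexD_alt[OF that] assms(5,6) by simp
  qed
  show ?thesis
    using assms(1-4) by (auto simp: hw_feasible_def PiE_iff extensional_def intro!: seg)
qed

lemma hw_optimal_iff_slope_nonneg:
  assumes "(a, x) \<in> hw_feasible m C S"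
    and "\<And>i. i \<in> {1..m} \<Longrightarrow> convex (C i)" and "convex S"
    and "\<And>i. i \<in> {1..m} \<Longrightarrow> \<rho> i \<ge> 0" and "\<And>i. i \<in> {1..m} \<Longrightarrow> \<omega> i \<ge> 0"
    and "\<And>i. i \<in> {1..m} \<Longrightarrow> a i \<noteq> a (cnext m i)" and "\<And>i. i \<in> {1..m} \<Longrightarrow> a i \<noteq> x"
  shows "hw_optimal m C S \<rho> \<omega> (a, x) \<longleftrightarrow>
    (\<forall>(b, y) \<in> hw_feasible m C S. hw_slope m \<rho> \<omega> a x (\<lambda>i. b i - a i) (y - x) \<ge> 0)"
    (is "?opt \<longleftrightarrow> ?slope")
proof
  assume opt: ?opt
  show ?slope
  proof clarify
    fix b y assume feas: "(b, y) \<in> hw_feasible m C S"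
    let ?f = "\<lambda>t. hw_objective m \<rho> \<omega> (\<lambda>i. a i + t *\<^sub>R (b i - a i), x + t *\<^sub>R (y - x))"
    let ?l = "hw_slope m \<rho> \<omega> a x (\<lambda>i. b i - a i) (y - x)"
    have der: "(?f has_real_derivative ?l) (at 0)"
      using assms(6,7) by (rule hw_objective_has_slope)
    show "?l \<ge> 0"
    proof (rule ccontr)
      assume "\<not> ?l \<ge> 0"
      then obtain d where d: "d > 0" "\<forall>h>0. h < d \<longrightarrow> ?f (0 + h) < ?f 0"
        using DERIV_neg_dec_right[OF der] by auto
      define h where "h = min (d / 2) 1"
      have h: "0 < h" "h < d" "h \<le> 1"
        using d(1) by (auto simp: h_def)
      have "?f h < hw_objective m \<rho> \<omega> (a, x)"
        using d(2)[rule_format, OF h(1,2)] by simp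
      moreover have "(\<lambda>i. a i + h *\<^sub>R (b i - a i), x + h *\<^sub>R (y - x)) \<in> hw_feasible m C S"
        using h by (intro hw_feasible_segment assms feas) auto
      ultimately show False
        using opt unfolding hw_optimal_def is_arg_min_def by blast
    qed
  qed
next
  assume slope: ?slope
  have "hw_objective m \<rho> \<omega> (a, x) \<le> hw_objective m \<rho> \<omega> (b, y)"
    if "(b, y) \<in> hw_feasible m C S" for b y
    using hw_objective_ge_linearization[OF assms(4,5), where a = a and x = x and b = b and y = y] slope that by fastforce
  then show ?opt
    using assms(1) unfolding hw_optimal_def is_arg_min_def by (auto simp: not_less)
qed

text \<open>
  The feasible set is a product, so one component can be moved while the others stay put; this
  splits the single inequality for the slope into one normal cone condition per component.
\<close>
lemma slope_nonneg_iff_normal: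
  assumes "(a, x) \<in> hw_feasible m C S"
  shows "(\<forall>(b, y) \<in> hw_feasible m C S. hw_slope m \<rho> \<omega> a x (\<lambda>i. b i - a i) (y - x) \<ge> 0) \<longleftrightarrow>
    (\<forall>i\<in>{1..m}. - hw_gradient_vertex m \<rho> \<omega> a x i \<in> normal_cone (C i) (a i))
    \<and> - hw_gradient_centre m \<omega> a x \<in> normal_cone S x" (is "?L \<longleftrightarrow> ?R")
proof
  assume L: ?L
  show ?R
  proof (intro conjI ballI)
    fix i assume i: "i \<in> {1..m}"
    show "- hw_gradient_vertex m \<rho> \<omega> a x i \<in> normal_cone (C i) (a i)"
      unfolding normal_cone_def
    proof clarify
      fix z assume z: "z \<in> C i"
      \<comment> \<open>Only the \<open>i\<close>-th vertex is moved, so the slope reduces to the \<open>i\<close>-th gradient term.\<close>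
      have "(a(i := z), x) \<in> hw_feasible m C S"
        using assms z i by (auto simp: hw_feasible_def PiE_iff extensional_def)
      with L have "0 \<le> hw_slope m \<rho> \<omega> a x (\<lambda>j. (a(i := z)) j - a j) (x - x)"
        by blast
      also have "\<dots> = (\<Sum>j=1..m. if j = i then hw_gradient_vertex m \<rho> \<omega> a x i \<bullet> (z - a i) else 0)"
        unfolding hw_slope_eq_gradients diff_self inner_zero_right add_0_right
        by (rule sum.cong) auto
      also have "\<dots> = hw_gradient_vertex m \<rho> \<omega> a x i \<bullet> (z - a i)"
        using i by simp
      finally show "- hw_gradient_vertex m \<rho> \<omega> a x i \<bullet> (z - a i) \<le> 0"
        by simp
    qed
  next
    show "- hw_gradient_centre m \<omega> a x \<in> normal_cone S x"
      unfolding normal_cone_def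
    proof clarify
      fix z assume "z \<in> S"
      then have "(a, z) \<in> hw_feasible m C S"
        using assms by (auto simp: hw_feasible_def)
      with L have "0 \<le> hw_slope m \<rho> \<omega> a x (\<lambda>j. a j - a j) (z - x)"
        by blast
      then show "- hw_gradient_centre m \<omega> a x \<bullet> (z - x) \<le> 0"
        unfolding hw_slope_eq_gradients by simp
    qed
  qed
next
  assume R: ?R
  show ?L
  proof clarify
    fix b y assume "(b, y) \<in> hw_feasible m C S"
    then have "\<And>i. i \<in> {1..m} \<Longrightarrow> b i \<in> C i" and "y \<in> S"
      by (auto simp: hw_feasible_def PiE_iff)
    with R show "hw_slope m \<rho> \<omega> a x (\<lambda>i. b i - a i) (y - x) \<ge> 0"
      unfolding hw_slope_eq_gradients normal_cone_def
      by (intro add_nonneg_nonneg sum_nonneg) auto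
  qed
qed

theorem theorem3p7:
  fixes m :: nat
    and C :: "nat \<Rightarrow> (real^'n) set" and S :: "(real^'n) set"
    and \<rho> \<omega> :: "nat \<Rightarrow> real"
    and a :: "nat \<Rightarrow> real^'n" and x :: "real^'n"
  assumes "m \<ge> 3"
    and "\<And>i. i \<in> {1..m} \<Longrightarrow> C i \<noteq> {} \<and> closed (C i) \<and> convex (C i)"
    and "S \<noteq> {}" and "closed S" and "convex S"
    and "\<And>i j. i \<in> {1..m} \<Longrightarrow> j \<in> {1..m} \<Longrightarrow> i \<noteq> j \<Longrightarrow> C i \<inter> C j = {}"
    and "\<And>i. i \<in> {1..m} \<Longrightarrow> C i \<inter> S = {}"
    and "\<And>i. i \<in> {1..m} \<Longrightarrow> \<rho> i \<ge> 0"
    and "\<And>i. i \<in> {1..m} \<Longrightarrow> \<omega> i \<ge> 0"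
    and "(a, x) \<in> hw_feasible m C S"
  shows "hw_optimal m C S \<rho> \<omega> (a, x) \<longleftrightarrow>
    (\<exists>(nC :: nat \<Rightarrow> real^'n) (nS :: real^'n).
       (\<forall>i\<in>{1..m}. nC i \<in> normal_cone (C i) (a i)) \<and> nS \<in> normal_cone S x \<and>
       (\<forall>i\<in>{1..m}.
          \<rho> (cprev m i) *\<^sub>R ((a i - a (cprev m i)) /\<^sub>R norm (a i - a (cprev m i)))
          + \<rho> i *\<^sub>R ((a i - a (cnext m i)) /\<^sub>R norm (a i - a (cnext m i)))
          + \<omega> i *\<^sub>R ((a i - x) /\<^sub>R norm (a i - x))
          + nC i = 0) \<and>
       (\<Sum>i=1..m. \<omega> i *\<^sub>R ((x - a i) /\<^sub>R norm (x - a i))) + nS = 0 \<and>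
       (\<Sum>i=1..m. nC i) + nS = 0)"
proof -
  note feas = assms(10)
  have mem: "a i \<in> C i" if "i \<in> {1..m}" for i
    using feas that by (auto simp: hw_feasible_def PiE_iff)
  have xS: "x \<in> S"
    using feas by (auto simp: hw_feasible_def)
  have edge: "a i \<noteq> a (cnext m i)" if i: "i \<in> {1..m}" for i
  proof -
    have "cnext m i \<in> {1..m}" "i \<noteq> cnext m i"
      using i \<open>m \<ge> 3\<close> by (auto simp: cnext_def)
    then show ?thesis
      using assms(6)[OF i] mem i by (metis disjoint_iff)
  qed
  have spoke: "a i \<noteq> x" if "i \<in> {1..m}" for i
    using assms(7)[OF that] mem[OF that] xS by auto
  let ?G = "hw_gradient_vertex m \<rho> \<omega> a x" and ?H = "hw_gradient_centre m \<omega> a x"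
  have "hw_optimal m C S \<rho> \<omega> (a, x) \<longleftrightarrow>
      (\<forall>i\<in>{1..m}. - ?G i \<in> normal_cone (C i) (a i)) \<and> - ?H \<in> normal_cone S x"
    unfolding slope_nonneg_iff_normal[OF feas, symmetric]
    by (rule hw_optimal_iff_slope_nonneg) (use feas assms(2,5,8,9) edge spoke in auto)
  also have "\<dots> \<longleftrightarrow> (\<exists>nC nS. (\<forall>i\<in>{1..m}. nC i \<in> normal_cone (C i) (a i)) \<and> nS \<in> normal_cone S x
      \<and> (\<forall>i\<in>{1..m}. ?G i + nC i = 0) \<and> ?H + nS = 0 \<and> (\<Sum>i=1..m. nC i) + nS = 0)"
    (is "?N \<longleftrightarrow> (\<exists>nC nS. ?P nC nS)")
  proof
    assume ?N
    moreover have "(\<Sum>i=1..m. - ?G i) + - ?H = 0"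
      using hw_gradients_sum_zero[of m \<rho> \<omega> a x]
      by (simp add: sum_negf neg_eq_iff_add_eq_0 add.commute)
    ultimately have "?P (\<lambda>i. - ?G i) (- ?H)"
      by simp
    then show "\<exists>nC nS. ?P nC nS"
      by (intro exI)
  next
    assume "\<exists>nC nS. ?P nC nS"
    then obtain nC nS where P: "?P nC nS"
      by blast
    then show ?N
      by (metis minus_unique)
  qed
  finally show ?thesis
    unfolding hw_gradient_vertex_def hw_gradient_centre_def sgn_div_norm .
qed

end
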